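(* Consider the robust distributed learning problem and Algorithm A described in the context. Assume: (1) For all $\theta,\theta_1,\theta_2\in\mathbb{R}^p$ and $z,z_1,z_2\in\mathbb{R}^d$: $\|\nabla_\theta f(\theta_1;z)-\nabla_\theta f(\theta_2;z)\|\le L_{\theta\theta}\|\theta_1-\theta_2\|$, $\|\nabla_\theta f(\theta;z_1)-\nabla_\theta f(\theta;z_2)\|\le L_{\theta z}\|z_1-z_2\|$, $\|\nabla_z f(\theta_1;z)-\nabla_z f(\theta_2;z)\|\le L_{z\theta}\|\theta_1-\theta_2\|$, $\|\nabla_z f(\theta;z_1)-\nabla_z f(\theta;z_2)\|\le L_{zz}\|z_1-z_2\|$. (2) For every $x$, the function $z\mapsto c(z,x)$ is $L_c$-smooth and $1$-strongly convex. (3) $\lambda>L_{zz}$. (4) For every iterate $\theta_t$, $\max_{1\le k\le N}\big\|\nabla_\theta f(\theta_t;z_k^*(\theta_t))-\frac1N\sum_{j=1}^N\nabla_\theta f(\theta_t;z_j^*(\theta_t))\big\|\le\sigma$. Let $L_F=L_{\theta\theta}+\frac{L_{\theta z}L_{z\theta}}{\lambda-L_{zz}}$ and $C_\alpha=\frac{2\alpha}{1-\beta}$, let $\theta^*$ be a global minimizer of $F$, and suppose $\alpha<\frac13$. If Algorithm A is run with $\eta=\frac1{L_F}$, then for every $r$ with $0<r<\big(\frac{1-\beta}{2\alpha}\big)^2-1$, $$\frac1T\sum_{t=0}^{T-1}\|\nabla F(\theta_t)\|^2\le\frac{2L_F}{\big(1-(1+r)C_\alpha^2\big)T}\big[F(\theta_0)-F(\theta^*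 )\big]+\frac{(1+1/r)(L_{\theta z}\varepsilon+\sigma)^2}{1-(1+r)C_\alpha^2}.$$
   Context: $\|\cdot\|$ is the Euclidean norm. A differentiable function is $L$-smooth if its gradient is $L$-Lipschitz. Problem. There are $m$ workers and $N=mn$ data points $x_1,\ldots,x_N\in\mathbb{R}^d$; worker $i$ holds $x_{(i-1)n+1},\ldots,x_{(i-1)n+n}$. $f(\theta;z)$ is a real-valued differentiable loss, $\theta\in\mathbb{R}^p$, $z\in\mathbb{R}^d$; $c(z,x)$ is a real-valued cost on $\mathbb{R}^d\times\mathbb{R}^d$; $\lambda\ge0$ is a fixed constant. Put $\phi_\lambda(\theta;x)=\sup_z\{f(\theta;z)-\lambda c(z,x)\}$ and $F(\theta)=\frac1N\sum_{j=1}^N\phi_\lambda(\theta;x_j)$. Let $z_j^*(\theta)=\arg\sup_z\{f(\theta;z)-\lambda c(z,x_j)\}$ denote the exact maximizer (unique under assumptions (1)-(3)). $\nabla_\theta f(\theta_t;z_j^*(\theta_t))$ denotes the gradient of $f$ in its first argument with the second argument held fixed, evaluated at $(\theta_t,z_j^*(\theta_t))$. The workers are partitioned into byzantine workers $\mathcal{B}$, $|\mathcal{B}|=\alpha m$, and honest workers $\mathcal{M}$, $|\mathcal{M}|=(1-\alpha)m$. Norm-based screening. For vectors $g_1,\ldots,g_m$, order indices so that $\|g_{(1)}\|\le\cdots\le\|g_{(m)}\|$ (ties broken arbitrarily), let $\mathcal{U}=\{(1),\ldots,((1-\beta)m)\}$, and set $\mathbf{Norm\_Screen}_\beta(g_1,\ldots,g_m)=\frac1{|\mathcal{U}|}\sum_{i\in\mathcal{U}}g_i$.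 Algorithm A (inputs: $\beta$ with $\alpha\le\beta<1$, step size $\eta$, initial $\theta_0$, number of iterations $T\ge1$, precision $\varepsilon\ge0$). For $t=0,\ldots,T-1$: for every sample $x_j$ of an honest worker, a point $z_j^\varepsilon(\theta_t)$ with $\|z_j^\varepsilon(\theta_t)-z_j^*(\theta_t)\|\le\varepsilon$ is obtained; each honest worker $i\in\mathcal{M}$ sends $g_i(\theta_t)=\frac1n\sum_{j=(i-1)n+1}^{(i-1)n+n}\nabla_\theta f(\theta_t;z_j^\varepsilon(\theta_t))$; each byzantine worker $i\in\mathcal{B}$ sends an arbitrary vector $g_i(\theta_t)\in\mathbb{R}^p$; the server computes $G(\theta_t)=\mathbf{Norm\_Screen}_\beta(g_1(\theta_t),\ldots,g_m(\theta_t))$ and sets $\theta_{t+1}=\theta_t-\eta\,G(\theta_t)$. Conventions: $\alpha\ge0$; $\alpha m$ and $(1-\beta)m$ are integers; $L_F>0$; if $\alpha=0$ the upper bound on $r$ is read as $+\infty$. *)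

theory Defs
  imports "HOL-Analysis.Analysis"
begin

definition grad :: "('a::real_inner \<Rightarrow> real) \<Rightarrow> 'a \<Rightarrow> 'a" where
  "grad h x = (THE D. GDERIV h x :> D)"

definition smooth_with :: "real \<Rightarrow> ('a::real_inner \<Rightarrow> real) \<Rightarrow> bool" where
  "smooth_with L h \<longleftrightarrow> (\<forall>x. h differentiable (at x)) \<and> L-lipschitz_on UNIV (grad h)"

definition strongly_convex :: "real \<Rightarrow> ('a::real_inner \<Rightarrow> real) \<Rightarrow> bool" where
  "strongly_convex \<mu> h \<longleftrightarrow>
     (\<forall>x y. \<forall>u\<in>{0..1}.
        h (u *\<^sub>R x + (1 - u) *\<^sub>R y)
          \<le> u * h x + (1 - u) * h y - \<mu> / 2 * u * (1 - u) * (norm (x - y))\<^sup>2)"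

definition robust_loss ::
  "('p \<Rightarrow> 'd \<Rightarrow> real) \<Rightarrow> ('d \<Rightarrow> 'd \<Rightarrow> real) \<Rightarrow> real \<Rightarrow> 'p \<Rightarrow> 'd \<Rightarrow> real" where
  "robust_loss f c lam \<theta> x = (SUP z. f \<theta> z - lam * c z x)"

text \<open>Data points are indexed from 1, so \<open>x 0\<close> is never used.\<close>

definition robust_objective ::
  "('p \<Rightarrow> 'd \<Rightarrow> real) \<Rightarrow> ('d \<Rightarrow> 'd \<Rightarrow> real) \<Rightarrow> real \<Rightarrow> (nat \<Rightarrow> 'd) \<Rightarrow> nat \<Rightarrow> 'p \<Rightarrow> real" where
  "robust_objective f c lam x N \<theta> = (1 / real N) * (\<Sum>j = 1..N. robust_loss f c lam \<theta> (x j))"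

definition zstar ::
  "('p \<Rightarrow> 'd \<Rightarrow> real) \<Rightarrow> ('d \<Rightarrow> 'd \<Rightarrow> real) \<Rightarrow> real \<Rightarrow> 'd \<Rightarrow> 'p \<Rightarrow> 'd" where
  "zstar f c lam x \<theta> = arg_max (\<lambda>z. f \<theta> z - lam * c z x) (\<lambda>z. True)"

definition samples :: "nat \<Rightarrow> nat \<Rightarrow> nat set" where
  "samples n i = {(i - 1) * n + 1 .. (i - 1) * n + n}"

text \<open>A relation, since any ordering \<open>\<pi>\<close> of the indices \<open>1, \<dots>, m\<close> that sorts the norms
  is allowed when there are ties. It is only used when \<open>(1 - \<beta>) * m\<close> is an integer,
  so that the floor does not round.\<close>

definition norm_screen ::
  "real \<Rightarrow> nat \<Rightarrow> (nat \<Rightarrow> 'a::real_normed_vector) \<Rightarrow> 'a \<Rightarrow> bool" where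
  "norm_screen \<beta> m g G \<longleftrightarrow>
     (\<exists>\<pi> U. bij_betw \<pi> {1..m} {1..m} \<and>
        mono_on {1..m} (\<lambda>k. norm (g (\<pi> k))) \<and>
        U = \<pi> ` {1..nat \<lfloor>(1 - \<beta>) * real m\<rfloor>} \<and>
        G = (1 / real (card U)) *\<^sub>R (\<Sum>i\<in>U. g i))"

text \<open>\<open>\<theta> t\<close> is the \<open>t\<close>-th iterate, \<open>z t j\<close> the approximate maximizer for the \<open>j\<close>-th data point
  and \<open>g t i\<close> the vector sent by worker \<open>i\<close> in iteration \<open>t\<close>; \<open>M\<close> is the set of honest workers.
  The vectors \<open>g t i\<close> with \<open>i\<close> outside \<open>M\<close> are unconstrained.\<close>

definition robust_gd_run ::
  "('p::real_inner \<Rightarrow> 'd::real_normed_vector \<Rightarrow> real) \<Rightarrow> ('d \<Rightarrow> 'd \<Rightarrow> real) \<Rightarrow> real \<Rightarrow> (nat \<Rightarrow> 'd)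
    \<Rightarrow> nat \<Rightarrow> nat \<Rightarrow> nat set \<Rightarrow> real \<Rightarrow> real \<Rightarrow> real \<Rightarrow> nat \<Rightarrow> 'p
    \<Rightarrow> (nat \<Rightarrow> 'p) \<Rightarrow> (nat \<Rightarrow> nat \<Rightarrow> 'd) \<Rightarrow> (nat \<Rightarrow> nat \<Rightarrow> 'p) \<Rightarrow> bool" where
  "robust_gd_run f c lam x m n M \<beta> \<eta> eps T \<theta>\<^sub>0 \<theta> z g \<longleftrightarrow>
     \<theta> 0 = \<theta>\<^sub>0 \<and>
     (\<forall>t<T.
        (\<forall>i\<in>M. \<forall>j\<in>samples n i. norm (z t j - zstar f c lam (x j) (\<theta> t)) \<le> eps) \<and>
        (\<forall>i\<in>M. g t i = (1 / real n) *\<^sub>R (\<Sum>j\<in>samples n i. grad (\<lambda>\<theta>'. f \<theta>' (z t j)) (\<theta> t))) \<and>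
        (\<exists>G. norm_screen \<beta> m (g t) G \<and> \<theta> (Suc t) = \<theta> t - \<eta> *\<^sub>R G))"

end

theory Submission
  imports Defs
begin

text \<open>Since \<open>f(\<theta>, \<cdot>) - \<lambda> c(\<cdot>, x)\<close> is \<open>(\<lambda> - L\<^sub>z\<^sub>z)\<close>-strongly concave, its maximizer exists and is
  \<open>L\<^sub>z\<^sub>\<theta> / (\<lambda> - L\<^sub>z\<^sub>z)\<close>-Lipschitz in \<open>\<theta>\<close>. A Danskin-type argument then shows that \<open>F\<close> is
  differentiable with an \<open>L\<^sub>F\<close>-Lipschitz gradient \<open>h\<close>. A byzantine vector that survives the screening
  displaces an honest one, so its norm is at most that of an honest vector; hence the screened mean
  differs from \<open>h\<close> by at most \<open>C\<^sub>\<alpha> \<parallel>h\<parallel> + (L\<^sub>\<theta>\<^sub>z \<epsilon> + \<sigma>)\<close>, and inexact gradient descent with step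
  \<open>1 / L\<^sub>F\<close> gives the bound.\<close>

section \<open>Gradients and their restrictions to lines\<close>

lemma gderiv_unique:
  assumes "GDERIV h x :> D" "GDERIV h x :> D'"
  shows "D = D'"
proof -
  have "(\<lambda>v. v \<bullet> D) = (\<lambda>v. v \<bullet> D')"
    using assms unfolding gderiv_def by (rule has_derivative_unique)
  then have "(D - D') \<bullet> D = (D - D') \<bullet> D'"
    by (rule fun_cong)
  then have "(D - D') \<bullet> (D - D') = 0"
    unfolding inner_diff_right [of "D - D'" D D'] by (rule right_minus_eq [THEN iffD2])
  then show ?thesis
    by simp
qed

lemma grad_eqI: "GDERIV h x :> D \<Longrightarrow> grad h x = D"
  unfolding grad_def by (rule the_equality) (auto intro: gderiv_unique)

text \<open>Riesz representation in finite dimension: the representing vector is assembled from the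
  values of the derivative on the basis. This makes the definite description in \<open>grad\<close>
  denote the actual gradient.\<close>

lemma gderiv_grad:
  fixes h :: "'a::euclidean_space \<Rightarrow> real"
  assumes "h differentiable (at x)"
  shows "GDERIV h x :> grad h x"
proof -
  obtain h' where h': "(h has_derivative h') (at x)"
    using assms unfolding differentiable_def by blast
  define D where "D = (\<Sum>b\<in>Basis. h' b *\<^sub>R b)"
  have lin: "linear h'"
    using h' by (rule has_derivative_linear)
  have "h' v = v \<bullet> D" for v
  proof -
    have "h' v = h' (\<Sum>b\<in>Basis. (v \<bullet> b) *\<^sub>R b)"
      by (simp add: euclidean_representation)
    also have "\<dots> = v \<bullet> D"
      by (simp add: linear_sum [OF lin] linear_cmul [OF lin] D_def inner_sum_right mult.commute)
    finally show ?thesis .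
  qed
  then have "h' = (\<lambda>v. v \<bullet> D)"
    by (rule ext)
  with h' have "GDERIV h x :> D"
    by (simp add: gderiv_def)
  with grad_eqI [OF this] show ?thesis
    by simp
qed

text \<open>Brings one-variable calculus to bear on the smoothness and strong convexity bounds
  below.\<close>

lemma gderiv_along_line:
  fixes h :: "'a::real_inner \<Rightarrow> real"
  assumes "GDERIV h (x + t *\<^sub>R d) :> D"
  shows "((\<lambda>t. h (x + t *\<^sub>R d)) has_real_derivative d \<bullet> D) (at t)"
proof -
  have line: "((\<lambda>t. x + t *\<^sub>R d) has_derivative (\<lambda>s. s *\<^sub>R d)) (at t)"
    by (auto intro!: derivative_eq_intros)
  have "((\<lambda>t. h (x + t *\<^sub>R d)) has_derivative (\<lambda>s. (s *\<^sub>R d) \<bullet> D)) (at t)"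
    by (rule has_derivative_compose [OF line]) (use assms in \<open>simp add: gderiv_def\<close>)
  then show ?thesis
    unfolding has_field_derivative_def
    by (elim has_derivative_eq_rhs) (auto simp: fun_eq_iff mult.commute)
qed

section \<open>Functions with Lipschitz gradient\<close>

text \<open>The descent lemma. Along the segment from \<open>x\<close> to \<open>y\<close>,
  \<open>h\<close> minus its linear part minus the quadratic term has nonpositive derivative, by
  Cauchy-Schwarz and the Lipschitz bound.\<close>

lemma lipschitz_gradient_upper_bound:
  fixes h :: "'a::real_inner \<Rightarrow> real"
  assumes D: "\<And>x. GDERIV h x :> D x"
    and lip: "\<And>x y. norm (D x - D y) \<le> L * norm (x - y)"
  shows "h y \<le> h x + (y - x) \<bullet> D x + L / 2 * (norm (y - x))\<^sup>2"
proof -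
  define d where "d = y - x"
  \<comment> \<open>Chosen so that \<open>q 1 \<le> q 0\<close> is exactly the claim.\<close>
  define q where "q t = h (x + t *\<^sub>R d) - t * (d \<bullet> D x) - L / 2 * (norm d)\<^sup>2 * t\<^sup>2" for t
  have "\<exists>q'. (q has_real_derivative q') (at t) \<and> q' \<le> 0" if "0 \<le> t" for t
  proof (intro exI conjI)
    show "(q has_real_derivative d \<bullet> D (x + t *\<^sub>R d) - d \<bullet> D x - L * (norm d)\<^sup>2 * t) (at t)"
      unfolding q_def
      by (rule derivative_eq_intros gderiv_along_line D refl | simp)+
    have "d \<bullet> D (x + t *\<^sub>R d) - d \<bullet> D x \<le> norm d * norm (D (x + t *\<^sub>R d) - D x)"
      by (metis inner_diff_right norm_cauchy_schwarz)
    also have "\<dots> \<le> norm d * (L * norm (x + t *\<^sub>R d - x))"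
      by (intro mult_left_mono lip norm_ge_zero)
    also have "\<dots> = L * (norm d)\<^sup>2 * t"
      using that by (simp add: power2_eq_square)
    finally show "d \<bullet> D (x + t *\<^sub>R d) - d \<bullet> D x - L * (norm d)\<^sup>2 * t \<le> 0"
      by simp
  qed
  then have "q 1 \<le> q 0"
    by (intro DERIV_nonpos_imp_nonincreasing [of 0 1 q]) simp_all
  then show ?thesis
    by (simp add: q_def d_def)
qed

lemma lipschitz_gradient_lower_bound:
  fixes h :: "'a::real_inner \<Rightarrow> real"
  assumes D: "\<And>x. GDERIV h x :> D x"
    and lip: "\<And>x y. norm (D x - D y) \<le> L * norm (x - y)"
  shows "h x + (y - x) \<bullet> D x - L / 2 * (norm (y - x))\<^sup>2 \<le> h y"
proof -
  have "- h y \<le> - h x + (y - x) \<bullet> - D x + L / 2 * (norm (y - x))\<^sup>2"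
  proof (rule lipschitz_gradient_upper_bound)
    show "GDERIV (\<lambda>x. - h x) x :> - D x" for x
      by (rule GDERIV_minus [OF D])
    show "norm (- D x - - D y) \<le> L * norm (x - y)" for x y
      using lip [of x y] by (simp add: norm_minus_commute)
  qed
  then show ?thesis
    by simp
qed

text \<open>The defining inequality, with the weight \<open>u\<close> on \<open>y\<close>, bounds
  the difference quotient at \<open>x\<close> in direction \<open>y - x\<close>; letting
  \<open>u\<close> tend to 0 from the right turns the quotient into the directional
  derivative.\<close>

lemma strongly_convex_lower_bound:
  fixes h :: "'a::real_inner \<Rightarrow> real"
  assumes sc: "strongly_convex \<mu> h" and D: "GDERIV h x :> D"
  shows "h x + (y - x) \<bullet> D + \<mu> / 2 * (norm (y - x))\<^sup>2 \<le> h y"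
proof -
  define d where "d = y - x"
  have "((\<lambda>u. h (x + u *\<^sub>R d)) has_real_derivative d \<bullet> D) (at 0)"
    by (rule gderiv_along_line) (simp add: D)
  then have "((\<lambda>u. (h (x + u *\<^sub>R d) - h x) / u) \<longlongrightarrow> d \<bullet> D) (at_right 0)"
    by (auto simp: has_field_derivative_iff intro: tendsto_mono [OF at_le])
  moreover have "((\<lambda>u. h y - h x - \<mu> / 2 * (1 - u) * (norm d)\<^sup>2)
      \<longlongrightarrow> h y - h x - \<mu> / 2 * (1 - 0) * (norm d)\<^sup>2) (at_right 0)"
    by (intro tendsto_intros)
  moreover have "eventually (\<lambda>u. (h (x + u *\<^sub>R d) - h x) / u
      \<le> h y - h x - \<mu> / 2 * (1 - u) * (norm d)\<^sup>2) (at_right 0)"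
    using eventually_at_right_real [OF zero_less_one]
  proof eventually_elim
    case (elim u)
    have "h (u *\<^sub>R y + (1 - u) *\<^sub>R x)
        \<le> u * h y + (1 - u) * h x - \<mu> / 2 * u * (1 - u) * (norm (y - x))\<^sup>2"
      using sc elim unfolding strongly_convex_def by auto
    moreover have "u *\<^sub>R y + (1 - u) *\<^sub>R x = x + u *\<^sub>R d"
      by (simp add: d_def algebra_simps)
    ultimately have "h (x + u *\<^sub>R d) - h x
        \<le> u * (h y - h x - \<mu> / 2 * (1 - u) * (norm d)\<^sup>2)"
      by (simp add: d_def algebra_simps)
    then show ?case
      using elim by (simp add: divide_le_eq mult.commute)
  qed
  ultimately have "d \<bullet> D \<le> h y - h x - \<mu> / 2 * (1 - 0) * (norm d)\<^sup>2"
    by (intro tendsto_le [OF trivial_limit_at_right_real])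
  then show ?thesis
    by (simp add: d_def)
qed

section \<open>Maximizers of strongly concave functions\<close>

text \<open>Far from the origin the quadratic decay beats the linear term, so a maximum over a
  compact ball is global.\<close>

lemma strongly_concave_has_max:
  fixes q :: "'a::euclidean_space \<Rightarrow> real"
  assumes D: "\<And>x. GDERIV q x :> D x" and "0 < \<mu>"
    and sc: "\<And>x y. q y \<le> q x + (y - x) \<bullet> D x - \<mu> / 2 * (norm (y - x))\<^sup>2"
  shows "\<exists>s. \<forall>y. q y \<le> q s"
proof -
  \<comment> \<open>The radius at which \<open>norm y * norm (D 0)\<close> equals
    \<open>\<mu> / 2 * (norm y)\<^sup>2\<close>.\<close>
  define R where "R = 2 * norm (D 0) / \<mu>"
  have outside: "q y \<le> q 0" if "R < norm y" for y
  proof -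
    have "y \<bullet> D 0 \<le> norm y * norm (D 0)"
      by (rule norm_cauchy_schwarz)
    also have "\<dots> \<le> norm y * (\<mu> / 2 * norm y)"
      using that \<open>0 < \<mu>\<close> by (intro mult_left_mono) (auto simp: R_def field_simps)
    finally show ?thesis
      using sc [of y 0] by (simp add: power2_eq_square algebra_simps)
  qed
  have "0 \<le> R"
    using \<open>0 < \<mu>\<close> by (simp add: R_def)
  have "continuous_on (cball 0 R) q"
    using D unfolding gderiv_def
    by (intro continuous_at_imp_continuous_on ballI has_derivative_continuous) blast
  then obtain s where "s \<in> cball 0 R" and s: "\<And>y. y \<in> cball 0 R \<Longrightarrow> q y \<le> q s"
    using continuous_attains_sup [of "cball 0 R" q] \<open>0 \<le> R\<close> by auto
  have "q y \<le> q s" for y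
    using s [of y] outside [of y] s [of 0] \<open>0 \<le> R\<close> by (cases "R < norm y") auto
  then show ?thesis
    by blast
qed

lemma gderiv_zero_at_max:
  fixes q :: "'a::euclidean_space \<Rightarrow> real"
  assumes "GDERIV q s :> D" and "\<And>y. q y \<le> q s"
  shows "D = 0"
proof -
  have "(\<lambda>v. v \<bullet> D) = (\<lambda>v. 0)"
    by (rule differential_zero_maxmin [of s UNIV])
       (use assms in \<open>auto simp: gderiv_def\<close>)
  then have "D \<bullet> D = 0"
    by (rule fun_cong)
  then show ?thesis
    by simp
qed

text \<open>Adding the concavity inequalities for the two orders of the maximizers cancels the
  function values and leaves the squared distance below an inner product with a gradient.\<close>

lemma strongly_concave_argmax_perturbation:
  fixes q\<^sub>1 q\<^sub>2 :: "'a::euclidean_space \<Rightarrow> real"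
  assumes D\<^sub>1: "\<And>x. GDERIV q\<^sub>1 x :> D\<^sub>1 x" and D\<^sub>2: "\<And>x. GDERIV q\<^sub>2 x :> D\<^sub>2 x" and "0 < \<mu>"
    and sc: "\<And>x y. q\<^sub>1 y \<le> q\<^sub>1 x + (y - x) \<bullet> D\<^sub>1 x - \<mu> / 2 * (norm (y - x))\<^sup>2"
    and s\<^sub>1: "\<And>y. q\<^sub>1 y \<le> q\<^sub>1 s\<^sub>1" and s\<^sub>2: "\<And>y. q\<^sub>2 y \<le> q\<^sub>2 s\<^sub>2"
  shows "norm (s\<^sub>1 - s\<^sub>2) \<le> norm (D\<^sub>1 s\<^sub>2 - D\<^sub>2 s\<^sub>2) / \<mu>"
proof -
  have zero: "D\<^sub>1 s\<^sub>1 = 0" "D\<^sub>2 s\<^sub>2 = 0"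
    using gderiv_zero_at_max [OF D\<^sub>1 s\<^sub>1] gderiv_zero_at_max [OF D\<^sub>2 s\<^sub>2] by auto
  have "\<mu> * (norm (s\<^sub>1 - s\<^sub>2))\<^sup>2 \<le> (s\<^sub>1 - s\<^sub>2) \<bullet> D\<^sub>1 s\<^sub>2"
    using sc [of s\<^sub>1 s\<^sub>2] sc [of s\<^sub>2 s\<^sub>1] zero by (simp add: norm_minus_commute)
  \<comment> \<open>Since \<open>D\<^sub>2 s\<^sub>2 = 0\<close>, subtracting it costs nothing and
    turns a gradient into a difference of gradients at one point.\<close>
  also have "\<dots> \<le> norm (s\<^sub>1 - s\<^sub>2) * norm (D\<^sub>1 s\<^sub>2 - D\<^sub>2 s\<^sub>2)"
    using norm_cauchy_schwarz [of "s\<^sub>1 - s\<^sub>2" "D\<^sub>1 s\<^sub>2"] zero by simp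
  finally have "norm (s\<^sub>1 - s\<^sub>2) * (\<mu> * norm (s\<^sub>1 - s\<^sub>2))
      \<le> norm (s\<^sub>1 - s\<^sub>2) * norm (D\<^sub>1 s\<^sub>2 - D\<^sub>2 s\<^sub>2)"
    by (simp add: power2_eq_square algebra_simps)
  then have "\<mu> * norm (s\<^sub>1 - s\<^sub>2) \<le> norm (D\<^sub>1 s\<^sub>2 - D\<^sub>2 s\<^sub>2)"
    by (cases "s\<^sub>1 = s\<^sub>2") auto
  with \<open>0 < \<mu>\<close> show ?thesis
    by (simp add: field_simps)
qed

text \<open>A quadratic remainder is o(\<open>norm (y - x)\<close>). This serves for value
  functions, which come with two-sided estimates but no chain rule.\<close>

lemma gderiv_quadratic_error:
  fixes h :: "'a::real_inner \<Rightarrow> real"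
  assumes "\<And>y. \<bar>h y - h x - (y - x) \<bullet> D\<bar> \<le> C * (norm (y - x))\<^sup>2"
  shows "GDERIV h x :> D"
  unfolding gderiv_def has_derivative_iff_norm
proof
  show "bounded_linear (\<lambda>v. v \<bullet> D)"
    by (rule bounded_linear_inner_left)
  have "((\<lambda>y. C * norm (y - x)) \<longlongrightarrow> C * norm (x - x)) (at x)"
    by (intro tendsto_intros)
  then have lim: "((\<lambda>y. C * norm (y - x)) \<longlongrightarrow> 0) (at x)"
    by simp
  show "((\<lambda>y. norm (h y - h x - (y - x) \<bullet> D) / norm (y - x)) \<longlongrightarrow> 0) (at x)"
  proof (rule tendsto_sandwich [OF _ _ tendsto_const lim])
    \<comment> \<open>The bound even holds at \<open>y = x\<close>, where the quotient is 0 by the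
      convention for division by zero.\<close>
    show "\<forall>\<^sub>F y in at x. norm (h y - h x - (y - x) \<bullet> D) / norm (y - x) \<le> C * norm (y - x)"
      using assms
      by (intro always_eventually allI)
         (auto simp: divide_le_eq power2_eq_square algebra_simps)
  qed simp
qed

text \<open>A Danskin-type result in which \<open>s\<close> need not be differentiable. Freezing the
  maximizer of \<theta> bounds the increment from below, freezing that of \<theta>' bounds it from
  above; the two linear terms differ by at most \<open>K\<close> times the squared distance.\<close>

lemma gderiv_max_value:
  fixes \<psi> :: "'a::real_inner \<Rightarrow> 'b::real_normed_vector \<Rightarrow> real"
  assumes D: "\<And>\<theta> z. GDERIV (\<lambda>\<theta>. \<psi> \<theta> z) \<theta> :> D \<theta> z"
    and lip\<^sub>1: "\<And>\<theta>\<^sub>1 \<theta>\<^sub>2 z. norm (D \<theta>\<^sub>1 z - D \<theta>\<^sub>2 z) \<le> L\<^sub>1 * norm (\<theta>\<^sub>1 - \<theta>\<^sub>2)"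
    and lip\<^sub>s: "\<And>\<theta>\<^sub>1 \<theta>\<^sub>2. norm (D \<theta> (s \<theta>\<^sub>1) - D \<theta> (s \<theta>\<^sub>2)) \<le> K * norm (\<theta>\<^sub>1 - \<theta>\<^sub>2)"
    and max: "\<And>\<theta> z. \<psi> \<theta> z \<le> \<psi> \<theta> (s \<theta>)"
    and "0 \<le> K"
  shows "GDERIV (\<lambda>\<theta>. \<psi> \<theta> (s \<theta>)) \<theta> :> D \<theta> (s \<theta>)"
proof (rule gderiv_quadratic_error)
  fix \<theta>'
  let ?d = "\<theta>' - \<theta>" and ?N = "(norm (\<theta>' - \<theta>))\<^sup>2"
  have "?d \<bullet> D \<theta> (s \<theta>) - L\<^sub>1 / 2 * ?N \<le> \<psi> \<theta>' (s \<theta>) - \<psi> \<theta> (s \<theta>)"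
    using lipschitz_gradient_lower_bound [OF D lip\<^sub>1, of \<theta> "s \<theta>" \<theta>'] by simp
  also have "\<dots> \<le> \<psi> \<theta>' (s \<theta>') - \<psi> \<theta> (s \<theta>)"
    using max [of \<theta>' "s \<theta>"] by simp
  finally have lower: "?d \<bullet> D \<theta> (s \<theta>) - L\<^sub>1 / 2 * ?N \<le> \<psi> \<theta>' (s \<theta>') - \<psi> \<theta> (s \<theta>)" .
  have "?d \<bullet> D \<theta> (s \<theta>') - ?d \<bullet> D \<theta> (s \<theta>) \<le> norm ?d * norm (D \<theta> (s \<theta>') - D \<theta> (s \<theta>))"
    by (metis inner_diff_right norm_cauchy_schwarz)
  also have "\<dots> \<le> norm ?d * (K * norm ?d)"
    by (intro mult_left_mono lip\<^sub>s norm_ge_zero)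
  finally have inner: "?d \<bullet> D \<theta> (s \<theta>') \<le> ?d \<bullet> D \<theta> (s \<theta>) + K * ?N"
    by (simp add: power2_eq_square algebra_simps)
  have "\<psi> \<theta>' (s \<theta>') - \<psi> \<theta> (s \<theta>) \<le> \<psi> \<theta>' (s \<theta>') - \<psi> \<theta> (s \<theta>')"
    using max [of \<theta> "s \<theta>'"] by simp
  also have "\<dots> \<le> ?d \<bullet> D \<theta> (s \<theta>') + L\<^sub>1 / 2 * ?N"
    using lipschitz_gradient_upper_bound [OF D lip\<^sub>1, of \<theta>' "s \<theta>'" \<theta>] by simp
  also note inner
  finally have "\<psi> \<theta>' (s \<theta>') - \<psi> \<theta> (s \<theta>) \<le> ?d \<bullet> D \<theta> (s \<theta>) + K * ?N + L\<^sub>1 / 2 * ?N"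
    by simp
  moreover have "0 \<le> K * ?N"
    using \<open>0 \<le> K\<close> by simp
  ultimately show "\<bar>\<psi> \<theta>' (s \<theta>') - \<psi> \<theta> (s \<theta>) - ?d \<bullet> D \<theta> (s \<theta>)\<bar> \<le> (K + L\<^sub>1 / 2) * ?N"
    using lower unfolding distrib_right by linarith
qed

section \<open>Norm-based screening and inexact gradient descent\<close>

text \<open>Each retained vector is charged \<open>s\<close>, and each byzantine one an extra
  \<open>2 * norm h\<close>. At most \<open>\<alpha> * m\<close> of the
  \<open>(1 - \<beta>) * m\<close> retained vectors are byzantine, which gives the coefficient of
  \<open>norm h\<close>.\<close>

lemma norm_screen_error:
  fixes g :: "nat \<Rightarrow> 'a::real_normed_vector"
  assumes screen: "norm_screen \<beta> m g G"
    and part: "B \<union> M = {1..m}" "B \<inter> M = {}"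
    and cards: "real (card B) = \<alpha> * real m" "real (card M) = (1 - \<alpha>) * real m"
    and "1 \<le> m" "\<alpha> \<le> \<beta>" "\<beta> < 1" "(1 - \<beta>) * real m \<in> \<int>"
    and honest: "\<And>i. i \<in> M \<Longrightarrow> norm (g i - h) \<le> s"
  shows "norm (G - h) \<le> 2 * \<alpha> / (1 - \<beta>) * norm h + s"
proof -
  obtain \<pi> U where bij: "bij_betw \<pi> {1..m} {1..m}"
    and mono: "mono_on {1..m} (\<lambda>k. norm (g (\<pi> k)))"
    and U: "U = \<pi> ` {1..nat \<lfloor>(1 - \<beta>) * real m\<rfloor>}"
    and G: "G = (1 / real (card U)) *\<^sub>R (\<Sum>i\<in>U. g i)"
    using screen unfolding norm_screen_def by blast
  define u where "u = nat \<lfloor>(1 - \<beta>) * real m\<rfloor>"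
  have pos: "0 < (1 - \<beta>) * real m"
    using \<open>1 \<le> m\<close> \<open>\<beta> < 1\<close> by simp
  \<comment> \<open>Integrality makes the floor exact.\<close>
  have u: "real u = (1 - \<beta>) * real m"
    using \<open>(1 - \<beta>) * real m \<in> \<int>\<close> pos unfolding u_def by (auto elim!: Ints_cases)
  have "real u \<le> real (card M)"
    unfolding u cards using \<open>\<alpha> \<le> \<beta>\<close> by (intro mult_right_mono) auto
  then have u_le_M: "u \<le> card M"
    by simp
  have finM: "finite M" "finite B" and M_sub: "M \<subseteq> {1..m}"
    using part by (metis finite_Un finite_atLeastAtMost, metis finite_Un finite_atLeastAtMost, blast)
  have "card M \<le> m"
    using card_mono [OF _ M_sub] by simp
  with u_le_M have u_le_m: "u \<le> m"
    by simp
  have U': "U = \<pi> ` {1..u}"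
    by (simp add: U u_def)
  have inj: "inj_on \<pi> {1..m}" and img: "\<pi> ` {1..m} = {1..m}"
    using bij by (auto simp: bij_betw_def)
  have cardU: "card U = u"
    unfolding U' using inj_on_subset [OF inj, of "{1..u}"] u_le_m by (simp add: card_image)
  have finU: "finite U"
    by (simp add: U')
  have U_sub: "U \<subseteq> B \<union> M"
    unfolding part U' using img u_le_m by auto
  have sorted: "norm (g i) \<le> norm (g k)" if "i \<in> U" "k \<in> {1..m} - U" for i k
  proof -
    obtain a where a: "a \<in> {1..u}" "i = \<pi> a"
      using \<open>i \<in> U\<close> U' by auto
    obtain b where b: "b \<in> {1..m}" "k = \<pi> b"
      using \<open>k \<in> {1..m} - U\<close> img by (metis DiffD1 imageE)
    have "u < b"
      using b that U' by (metis Diff_iff atLeastAtMost_iff imageI not_le)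
    then show ?thesis
      using mono_onD [OF mono, of a b] a b u_le_m by auto
  qed
  have byz: "norm (g i - h) \<le> 2 * norm h + s" if "i \<in> U" "i \<in> B" for i
  proof -
    \<comment> \<open>Pigeonhole: \<open>card U \<le> card M\<close>, so
      \<open>M \<subseteq> U\<close> would force \<open>M = U\<close>, leaving no room for the
      byzantine \<open>i\<close>. Hence some honest vector was screened out, and its norm dominates
      that of \<open>g i\<close>.\<close>
    have "\<not> M \<subseteq> U"
    proof
      assume "M \<subseteq> U"
      then have "M = U"
        using card_seteq [OF finU] u_le_M cardU by simp
      then show False
        using that part by auto
    qed
    then obtain k where k: "k \<in> M" "k \<notin> U"
      by blast
    have "norm (g i) \<le> norm (g k)"
      using sorted [OF \<open>i \<in> U\<close>, of k] k M_sub by auto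
    also have "\<dots> \<le> norm h + s"
      using honest [OF k(1)] norm_triangle_sub [of "g k" h] by simp
    finally show ?thesis
      using norm_triangle_ineq4 [of "g i" h] by simp
  qed
  have u_pos: "0 < real u"
    using pos u by simp
  have "G - h = (1 / real u) *\<^sub>R (\<Sum>i\<in>U. g i - h)"
    using u_pos by (simp add: G cardU sum_subtractf scaleR_right_diff_distrib sum_constant_scaleR del: sum_constant)
  then have "real u * norm (G - h) = norm (\<Sum>i\<in>U. g i - h)"
    using u_pos by simp
  also have "\<dots> \<le> (\<Sum>i\<in>U. norm (g i - h))"
    by (rule norm_sum)
  also have "\<dots> \<le> (\<Sum>i\<in>U. s + (if i \<in> B then 2 * norm h else 0))"
    using byz honest U_sub by (intro sum_mono) (auto simp: add.commute)
  also have "\<dots> = real u * s + real (card (U \<inter> B)) * (2 * norm h)"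
    using finU by (simp add: sum.distrib cardU sum.If_cases)
  also have "\<dots> \<le> real u * s + real (card B) * (2 * norm h)"
    using finM by (intro add_left_mono mult_right_mono) (auto intro: card_mono)
  also have "\<dots> = real u * (2 * \<alpha> / (1 - \<beta>) * norm h + s)"
    using \<open>\<beta> < 1\<close> unfolding u cards by (simp add: field_simps)
  finally show ?thesis
    using u_pos by simp
qed

text \<open>Young's inequality: the two sides differ by a square divided by \<open>r\<close>. The
  parameter \<open>r\<close> trades the error proportional to the gradient against the constant
  error.\<close>

lemma weighted_square_sum_le:
  fixes a b r :: real
  assumes "0 < r"
  shows "(a + b)\<^sup>2 \<le> (1 + r) * a\<^sup>2 + (1 + 1 / r) * b\<^sup>2"
proof -
  have "(1 + r) * a\<^sup>2 + (1 + 1 / r) * b\<^sup>2 - (a + b)\<^sup>2 = (r * a - b)\<^sup>2 / r"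
    using assms by (simp add: field_simps power2_eq_square)
  also have "\<dots> \<ge> 0"
    using assms by simp
  finally show ?thesis
    by simp
qed

text \<open>The part of the squared error proportional to the squared gradient norm is absorbed,
  which needs \<open>(1 + r) * C\<^sup>2 < 1\<close>; the function values telescope and the minimum
  bounds the last one.\<close>

lemma inexact_gradient_descent:
  fixes F :: "'a::real_inner \<Rightarrow> real"
  assumes D: "\<And>x. GDERIV F x :> D x"
    and lip: "\<And>x y. norm (D x - D y) \<le> L * norm (x - y)"
    and "0 < L" "0 < r" "1 \<le> T"
    and C: "(1 + r) * C\<^sup>2 < 1"
    and step: "\<And>t. t < T \<Longrightarrow> \<exists>G. \<theta> (Suc t) = \<theta> t - (1 / L) *\<^sub>R G
                   \<and> norm (G - D (\<theta> t)) \<le> C * norm (D (\<theta> t)) + s"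
    and min: "\<And>x. F x\<^sub>0 \<le> F x"
  shows "(1 / real T) * (\<Sum>t<T. (norm (D (\<theta> t)))\<^sup>2)
           \<le> 2 * L / ((1 - (1 + r) * C\<^sup>2) * real T) * (F (\<theta> 0) - F x\<^sub>0)
             + (1 + 1 / r) * s\<^sup>2 / (1 - (1 + r) * C\<^sup>2)"
proof -
  define \<kappa> where "\<kappa> = 1 - (1 + r) * C\<^sup>2"
  define e where "e = (1 + 1 / r) * s\<^sup>2"
  have "0 < \<kappa>"
    using C by (simp add: \<kappa>_def)
  have one_step: "\<kappa> * (norm (D (\<theta> t)))\<^sup>2 \<le> 2 * L * (F (\<theta> t) - F (\<theta> (Suc t))) + e" if t: "t < T" for t
  proof -
    let ?h = "D (\<theta> t)"
    obtain G where next_it: "\<theta> (Suc t) = \<theta> t - (1 / L) *\<^sub>R G"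
      and err: "norm (G - ?h) \<le> C * norm ?h + s"
      using step [OF t] by blast
    have "F (\<theta> (Suc t)) \<le> F (\<theta> t) + (\<theta> (Suc t) - \<theta> t) \<bullet> ?h
        + L / 2 * (norm (\<theta> (Suc t) - \<theta> t))\<^sup>2"
      by (rule lipschitz_gradient_upper_bound [OF D lip])
    also have "\<dots> = F (\<theta> t) - (1 / L) * (G \<bullet> ?h) + L / 2 * ((1 / L) * norm G)\<^sup>2"
      using \<open>0 < L\<close> by (simp add: next_it)
    also have "\<dots> = F (\<theta> t) - (1 / L) * (G \<bullet> ?h) + 1 / (2 * L) * (norm G)\<^sup>2"
      using \<open>0 < L\<close> by (simp add: power2_eq_square)
    finally have "2 * L * F (\<theta> (Suc t)) \<le> 2 * L * (F (\<theta> t) - (1 / L) * (G \<bullet> ?h) + 1 / (2 * L) * (norm G)\<^sup>2)"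
      using \<open>0 < L\<close> by (intro mult_left_mono) auto
    also have "\<dots> = 2 * L * F (\<theta> t) - 2 * (G \<bullet> ?h) + (norm G)\<^sup>2"
      using \<open>0 < L\<close> by (simp add: field_simps)
    \<comment> \<open>Completing the square: with step \<open>1 / L\<close> the terms in
      \<open>G\<close> combine exactly into the squared gradient error.\<close>
    also have "\<dots> = 2 * L * F (\<theta> t) - (norm ?h)\<^sup>2 + (norm (G - ?h))\<^sup>2"
      by (simp add: power2_norm_eq_inner inner_diff_left inner_diff_right inner_commute)
    also have "(norm (G - ?h))\<^sup>2 \<le> (C * norm ?h + s)\<^sup>2"
      using err by (intro power_mono) auto
    also have "\<dots> \<le> (1 + r) * (C * norm ?h)\<^sup>2 + e"
      unfolding e_def by (rule weighted_square_sum_le [OF \<open>0 < r\<close>])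
    finally show ?thesis
      by (simp add: \<kappa>_def algebra_simps power_mult_distrib)
  qed
  have "\<kappa> * (\<Sum>t<T. (norm (D (\<theta> t)))\<^sup>2) \<le> (\<Sum>t<T. 2 * L * (F (\<theta> t) - F (\<theta> (Suc t))) + e)"
    unfolding sum_distrib_left by (intro sum_mono one_step) simp
  also have "\<dots> = 2 * L * (F (\<theta> 0) - F (\<theta> T)) + real T * e"
    using sum_lessThan_telescope' [of "\<lambda>t. F (\<theta> t)" T]
    by (simp add: sum.distrib sum_distrib_left [symmetric])
  also have "\<dots> \<le> 2 * L * (F (\<theta> 0) - F x\<^sub>0) + real T * e"
    using min [of "\<theta> T"] \<open>0 < L\<close> by simp
  finally have "(\<Sum>t<T. (norm (D (\<theta> t)))\<^sup>2) \<le> (2 * L * (F (\<theta> 0) - F x\<^sub>0) + real T * e) / \<kappa>"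
    using \<open>0 < \<kappa>\<close> by (simp add: field_simps)
  then have "(1 / real T) * (\<Sum>t<T. (norm (D (\<theta> t)))\<^sup>2)
      \<le> (1 / real T) * ((2 * L * (F (\<theta> 0) - F x\<^sub>0) + real T * e) / \<kappa>)"
    by (rule mult_left_mono) simp
  also have "\<dots> = 2 * L / (\<kappa> * real T) * (F (\<theta> 0) - F x\<^sub>0) + e / \<kappa>"
    using \<open>1 \<le> T\<close> \<open>0 < \<kappa>\<close> by (simp add: field_simps)
  finally show ?thesis
    unfolding \<kappa>_def e_def .
qed

section \<open>Convergence of norm-screened descent on the robust objective\<close>

theorem theorem2:
  fixes f :: "real^'p \<Rightarrow> real^'d \<Rightarrow> real"
    and c :: "real^'d \<Rightarrow> real^'d \<Rightarrow> real"
    and x :: "nat \<Rightarrow> real^'d"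
    and m n N T :: nat
    and B M :: "nat set"
    and lam \<alpha> \<beta> \<eta> eps \<sigma> r C\<^sub>\<alpha> :: real
    and L\<^sub>\<theta>\<^sub>\<theta> L\<^sub>\<theta>\<^sub>z L\<^sub>z\<^sub>\<theta> L\<^sub>z\<^sub>z L\<^sub>c L\<^sub>F :: real
    and F :: "real^'p \<Rightarrow> real"
    and \<theta>\<^sub>0 \<theta>_opt :: "real^'p"
    and \<theta> :: "nat \<Rightarrow> real^'p"
    and z :: "nat \<Rightarrow> nat \<Rightarrow> real^'d"
    and g :: "nat \<Rightarrow> nat \<Rightarrow> real^'p"
  assumes "1 \<le> m" and "1 \<le> n" and "N = m * n" and "1 \<le> T"
    and "B \<union> M = {1..m}" and "B \<inter> M = {}"
    and "real (card B) = \<alpha> * real m" and "real (card M) = (1 - \<alpha>) * real m"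
    and "0 \<le> \<alpha>" and "\<alpha> \<le> \<beta>" and "\<beta> < 1" and "(1 - \<beta>) * real m \<in> \<int>"
    and "0 \<le> lam" and "0 \<le> eps"
    and "\<And>\<theta>' z'. (\<lambda>(\<theta>', z'). f \<theta>' z') differentiable (at (\<theta>', z'))"
    and "\<And>\<theta>\<^sub>1 \<theta>\<^sub>2 z'. norm (grad (\<lambda>\<theta>'. f \<theta>' z') \<theta>\<^sub>1 - grad (\<lambda>\<theta>'. f \<theta>' z') \<theta>\<^sub>2)
                      \<le> L\<^sub>\<theta>\<^sub>\<theta> * norm (\<theta>\<^sub>1 - \<theta>\<^sub>2)"
    and "\<And>\<theta>' z\<^sub>1 z\<^sub>2. norm (grad (\<lambda>\<theta>'. f \<theta>' z\<^sub>1) \<theta>' - grad (\<lambda>\<theta>'. f \<theta>' z\<^sub>2) \<theta>')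
                      \<le> L\<^sub>\<theta>\<^sub>z * norm (z\<^sub>1 - z\<^sub>2)"
    and "\<And>\<theta>\<^sub>1 \<theta>\<^sub>2 z'. norm (grad (\<lambda>z'. f \<theta>\<^sub>1 z') z' - grad (\<lambda>z'. f \<theta>\<^sub>2 z') z')
                      \<le> L\<^sub>z\<^sub>\<theta> * norm (\<theta>\<^sub>1 - \<theta>\<^sub>2)"
    and "\<And>\<theta>' z\<^sub>1 z\<^sub>2. norm (grad (\<lambda>z'. f \<theta>' z') z\<^sub>1 - grad (\<lambda>z'. f \<theta>' z') z\<^sub>2)
                      \<le> L\<^sub>z\<^sub>z * norm (z\<^sub>1 - z\<^sub>2)"
    and "\<And>x'. smooth_with L\<^sub>c (\<lambda>z'. c z' x')"
    and "\<And>x'. strongly_convex 1 (\<lambda>z'. c z' x')"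
    and "L\<^sub>z\<^sub>z < lam"
    and "L\<^sub>F = L\<^sub>\<theta>\<^sub>\<theta> + L\<^sub>\<theta>\<^sub>z * L\<^sub>z\<^sub>\<theta> / (lam - L\<^sub>z\<^sub>z)" and "0 < L\<^sub>F"
    and "C\<^sub>\<alpha> = 2 * \<alpha> / (1 - \<beta>)"
    and "F = robust_objective f c lam x N"
    and "\<And>\<theta>'. F \<theta>_opt \<le> F \<theta>'"
    and "\<alpha> < 1 / 3"
    and "\<eta> = 1 / L\<^sub>F"
    and "robust_gd_run f c lam x m n M \<beta> \<eta> eps T \<theta>\<^sub>0 \<theta> z g"
    and "\<And>t. t < T \<Longrightarrow>
           Max ((\<lambda>k. norm (grad (\<lambda>\<theta>'. f \<theta>' (zstar f c lam (x k) (\<theta> t))) (\<theta> t)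
                  - (1 / real N) *\<^sub>R
                      (\<Sum>j = 1..N. grad (\<lambda>\<theta>'. f \<theta>' (zstar f c lam (x j) (\<theta> t))) (\<theta> t))))
                ` {1..N}) \<le> \<sigma>"
    and "0 < r" and "\<alpha> \<noteq> 0 \<Longrightarrow> r < ((1 - \<beta>) / (2 * \<alpha>))\<^sup>2 - 1"
  shows "(1 / real T) * (\<Sum>t<T. (norm (grad F (\<theta> t)))\<^sup>2)
           \<le> 2 * L\<^sub>F / ((1 - (1 + r) * C\<^sub>\<alpha>\<^sup>2) * real T) * (F \<theta>\<^sub>0 - F \<theta>_opt)
             + (1 + 1 / r) * (L\<^sub>\<theta>\<^sub>z * eps + \<sigma>)\<^sup>2 / (1 - (1 + r) * C\<^sub>\<alpha>\<^sup>2)"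
proof -
  note smooth = assms(15-19) and cost = assms(20,21)
  note run = assms(30) [unfolded robust_gd_run_def] and dev = assms(31)
  define Df where "Df \<theta>' z' = grad (\<lambda>\<theta>'. f \<theta>' z') \<theta>'" for \<theta>' z'
  define \<psi> where "\<psi> j \<theta>' z' = f \<theta>' z' - lam * c z' (x j)" for j \<theta>' z'
  define D\<psi> where "D\<psi> j \<theta>' z' = grad (f \<theta>') z' - lam *\<^sub>R grad (\<lambda>z'. c z' (x j)) z'" for j \<theta>' z'
  define zs where "zs j \<theta>' = zstar f c lam (x j) \<theta>'" for j \<theta>'
  define \<mu> where "\<mu> = lam - L\<^sub>z\<^sub>z"
  \<comment> \<open>The candidate for the gradient of \<open>F\<close>; it is also the mean
    occurring in the \<sigma> assumption.\<close>
  define h where "h \<theta>' = (1 / real N) *\<^sub>R (\<Sum>j = 1..N. Df \<theta>' (zs j \<theta>'))" for \<theta>'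

  have "0 < \<mu>"
    using \<open>L\<^sub>z\<^sub>z < lam\<close> by (simp add: \<mu>_def)
  have "1 \<le> N"
    using \<open>1 \<le> m\<close> \<open>1 \<le> n\<close> \<open>N = m * n\<close> by simp
  have "0 \<le> L\<^sub>\<theta>\<^sub>z"
    \<comment> \<open>The sign of the constant follows from the Lipschitz bound at two points at
      distance 1: a unit vector along an arbitrary axis, and 0.\<close>
    using norm_ge_zero [THEN order_trans, OF smooth(3) [where z\<^sub>1 = "axis undefined 1" and z\<^sub>2 = 0]]
    by simp
  have "0 \<le> L\<^sub>z\<^sub>\<theta>"
    using norm_ge_zero [THEN order_trans, OF smooth(4) [where \<theta>\<^sub>1 = "axis undefined 1" and \<theta>\<^sub>2 = 0]]
    by simp

  have Df: "GDERIV (\<lambda>\<theta>'. f \<theta>' z') \<theta>' :> Df \<theta>' z'" for \<theta>' z'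
  proof -
    have "(\<lambda>\<theta>'. (case (\<theta>', z') of (\<theta>', z') \<Rightarrow> f \<theta>' z')) differentiable (at \<theta>')"
      by (rule differentiable_compose [where g = "\<lambda>\<theta>'. (\<theta>', z')"])
         (auto intro: smooth(1) differentiable_Pair)
    then show ?thesis
      unfolding Df_def by (intro gderiv_grad) simp
  qed
  have Dz: "GDERIV (f \<theta>') z' :> grad (f \<theta>') z'" for \<theta>' z'
  proof -
    have "(\<lambda>z'. (case (\<theta>', z') of (\<theta>', z') \<Rightarrow> f \<theta>' z')) differentiable (at z')"
      by (rule differentiable_compose [where g = "\<lambda>z'. (\<theta>', z')"])
         (auto intro: smooth(1) differentiable_Pair)
    then show ?thesis
      by (intro gderiv_grad) simp
  qed
  have Dc: "GDERIV (\<lambda>z'. c z' (x j)) z' :> grad (\<lambda>z'. c z' (x j)) z'" for j z'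
    using cost(1) unfolding smooth_with_def by (intro gderiv_grad) blast
  have D\<psi>: "GDERIV (\<psi> j \<theta>') z' :> D\<psi> j \<theta>' z'" for j \<theta>' z'
    using Dz [of \<theta>' z'] Dc [of j z'] unfolding \<psi>_def [abs_def] D\<psi>_def gderiv_def
    by (auto intro!: derivative_eq_intros simp: inner_diff_right)
  \<comment> \<open>The loss curves upwards by at most \<open>L\<^sub>z\<^sub>z\<close>, while the
    cost, scaled by \<open>lam \<ge> 0\<close>, contributes at least \<open>lam\<close> downwards;
    \<mu> is the surplus.\<close>
  have concave: "\<psi> j \<theta>' y \<le> \<psi> j \<theta>' z' + (y - z') \<bullet> D\<psi> j \<theta>' z' - \<mu> / 2 * (norm (y - z'))\<^sup>2"
    for j \<theta>' z' y
  proof -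
    have "f \<theta>' y \<le> f \<theta>' z' + (y - z') \<bullet> grad (f \<theta>') z' + L\<^sub>z\<^sub>z / 2 * (norm (y - z'))\<^sup>2"
      by (rule lipschitz_gradient_upper_bound [OF Dz]) (use smooth(5) in simp)
    moreover have "lam * (c z' (x j) + (y - z') \<bullet> grad (\<lambda>z'. c z' (x j)) z'
        + 1 / 2 * (norm (y - z'))\<^sup>2) \<le> lam * c y (x j)"
      by (intro mult_left_mono strongly_convex_lower_bound [OF cost(2) Dc] \<open>0 \<le> lam\<close>)
    ultimately show ?thesis
      by (simp add: \<psi>_def D\<psi>_def \<mu>_def inner_diff_right algebra_simps diff_divide_distrib)
  qed

  have zs_max: "\<psi> j \<theta>' z' \<le> \<psi> j \<theta>' (zs j \<theta>')" for j \<theta>' z'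
  proof -
    obtain s where "\<And>y. \<psi> j \<theta>' y \<le> \<psi> j \<theta>' s"
      using strongly_concave_has_max [OF D\<psi> \<open>0 < \<mu>\<close> concave] by blast
    then have "is_arg_max (\<psi> j \<theta>') (\<lambda>z. True) s"
      by (auto simp: is_arg_max_linorder)
    \<comment> \<open>\<open>zstar\<close> is a Hilbert choice, so existence of some maximizer is
      what makes it one.\<close>
    then have "is_arg_max (\<psi> j \<theta>') (\<lambda>z. True) (zs j \<theta>')"
      unfolding zs_def zstar_def arg_max_def \<psi>_def [abs_def] by (rule someI)
    then show ?thesis
      by (auto simp: is_arg_max_linorder)
  qed
  have loss: "robust_loss f c lam \<theta>' (x j) = \<psi> j \<theta>' (zs j \<theta>')" for j \<theta>'
    unfolding robust_loss_def
    by (rule cSup_eq_maximum) (use zs_max in \<open>auto simp: \<psi>_def\<close>)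
  have zs_lip: "norm (zs j \<theta>\<^sub>1 - zs j \<theta>\<^sub>2) \<le> L\<^sub>z\<^sub>\<theta> / \<mu> * norm (\<theta>\<^sub>1 - \<theta>\<^sub>2)" for j \<theta>\<^sub>1 \<theta>\<^sub>2
  proof -
    have "norm (zs j \<theta>\<^sub>1 - zs j \<theta>\<^sub>2)
        \<le> norm (D\<psi> j \<theta>\<^sub>1 (zs j \<theta>\<^sub>2) - D\<psi> j \<theta>\<^sub>2 (zs j \<theta>\<^sub>2)) / \<mu>"
      by (rule strongly_concave_argmax_perturbation [OF D\<psi> D\<psi> \<open>0 < \<mu>\<close> concave zs_max zs_max])
    \<comment> \<open>The cost does not depend on \<theta>, so its gradients cancel and only those
      of \<open>f\<close> remain.\<close>
    also have "\<dots> \<le> (L\<^sub>z\<^sub>\<theta> * norm (\<theta>\<^sub>1 - \<theta>\<^sub>2)) / \<mu>"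
      using \<open>0 < \<mu>\<close> smooth(4) by (intro divide_right_mono) (auto simp: D\<psi>_def)
    finally show ?thesis
      by simp
  qed
  define K where "K = L\<^sub>\<theta>\<^sub>z * L\<^sub>z\<^sub>\<theta> / \<mu>"
  have "0 \<le> K"
    using \<open>0 \<le> L\<^sub>\<theta>\<^sub>z\<close> \<open>0 \<le> L\<^sub>z\<^sub>\<theta>\<close> \<open>0 < \<mu>\<close> by (simp add: K_def)
  have Df_lip: "norm (Df \<theta>\<^sub>1 z' - Df \<theta>\<^sub>2 z') \<le> L\<^sub>\<theta>\<^sub>\<theta> * norm (\<theta>\<^sub>1 - \<theta>\<^sub>2)" for \<theta>\<^sub>1 \<theta>\<^sub>2 z'
    unfolding Df_def by (rule smooth(2))
  have Df_zs_lip: "norm (Df \<theta>' (zs j \<theta>\<^sub>1) - Df \<theta>' (zs j \<theta>\<^sub>2)) \<le> K * norm (\<theta>\<^sub>1 - \<theta>\<^sub>2)"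
    for j \<theta>' \<theta>\<^sub>1 \<theta>\<^sub>2
  proof -
    have "norm (Df \<theta>' (zs j \<theta>\<^sub>1) - Df \<theta>' (zs j \<theta>\<^sub>2)) \<le> L\<^sub>\<theta>\<^sub>z * norm (zs j \<theta>\<^sub>1 - zs j \<theta>\<^sub>2)"
      unfolding Df_def by (rule smooth(3))
    also have "\<dots> \<le> L\<^sub>\<theta>\<^sub>z * (L\<^sub>z\<^sub>\<theta> / \<mu> * norm (\<theta>\<^sub>1 - \<theta>\<^sub>2))"
      by (intro mult_left_mono zs_lip \<open>0 \<le> L\<^sub>\<theta>\<^sub>z\<close>)
    finally show ?thesis
      by (simp add: K_def)
  qed
  have loss_gderiv: "GDERIV (\<lambda>\<theta>'. \<psi> j \<theta>' (zs j \<theta>')) \<theta>' :> Df \<theta>' (zs j \<theta>')" for j \<theta>'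
  proof (rule gderiv_max_value [where D = Df])
    show "GDERIV (\<lambda>\<theta>'. \<psi> j \<theta>' z') \<theta>' :> Df \<theta>' z'" for \<theta>' z'
      using GDERIV_diff [OF Df GDERIV_const] by (simp add: \<psi>_def)
  qed (use Df_lip Df_zs_lip zs_max \<open>0 \<le> K\<close> in auto)

  \<comment> \<open>The gradient of the objective and its Lipschitz constant\<close>
  have F_gderiv: "GDERIV F \<theta>' :> h \<theta>'" for \<theta>'
  proof -
    have F: "F = (\<lambda>\<theta>'. (1 / real N) * (\<Sum>j = 1..N. \<psi> j \<theta>' (zs j \<theta>')))"
      by (simp add: assms(26) robust_objective_def loss fun_eq_iff)
    show ?thesis
      unfolding F h_def gderiv_def inner_scaleR_right inner_sum_right
      using loss_gderiv unfolding gderiv_def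
      by (intro has_derivative_mult_right has_derivative_sum)
  qed
  have h_lip: "norm (h \<theta>\<^sub>1 - h \<theta>\<^sub>2) \<le> L\<^sub>F * norm (\<theta>\<^sub>1 - \<theta>\<^sub>2)" for \<theta>\<^sub>1 \<theta>\<^sub>2
  proof -
    \<comment> \<open>First \<theta> moves with the maximizer fixed, then the maximizer moves; the
      costs are \<open>L\<^sub>\<theta>\<^sub>\<theta>\<close> and \<open>K\<close>, which add up to
      \<open>L\<^sub>F\<close>.\<close>
    have "norm (Df \<theta>\<^sub>1 (zs j \<theta>\<^sub>1) - Df \<theta>\<^sub>2 (zs j \<theta>\<^sub>2)) \<le> L\<^sub>F * norm (\<theta>\<^sub>1 - \<theta>\<^sub>2)" for j
      using norm_triangle_ineq [of "Df \<theta>\<^sub>1 (zs j \<theta>\<^sub>1) - Df \<theta>\<^sub>2 (zs j \<theta>\<^sub>1)"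
          "Df \<theta>\<^sub>2 (zs j \<theta>\<^sub>1) - Df \<theta>\<^sub>2 (zs j \<theta>\<^sub>2)"]
        Df_lip [of \<theta>\<^sub>1 "zs j \<theta>\<^sub>1" \<theta>\<^sub>2] Df_zs_lip [of \<theta>\<^sub>2 j \<theta>\<^sub>1 \<theta>\<^sub>2] assms(23)
      by (simp add: K_def \<mu>_def distrib_right)
    then have "norm (\<Sum>j = 1..N. Df \<theta>\<^sub>1 (zs j \<theta>\<^sub>1) - Df \<theta>\<^sub>2 (zs j \<theta>\<^sub>2))
        \<le> (\<Sum>j = 1..N. L\<^sub>F * norm (\<theta>\<^sub>1 - \<theta>\<^sub>2))"
      by (intro sum_norm_le) auto
    then show ?thesis
      using \<open>1 \<le> N\<close>
      by (simp add: h_def scaleR_diff_right [symmetric] sum_subtractf [symmetric] field_simps)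
  qed

  \<comment> \<open>Error of the honest workers\<close>
  have honest: "norm (g t i - h (\<theta> t)) \<le> L\<^sub>\<theta>\<^sub>z * eps + \<sigma>" if "t < T" "i \<in> M" for t i
  proof -
    have gi: "g t i = (1 / real n) *\<^sub>R (\<Sum>j\<in>samples n i. Df (\<theta> t) (z t j))"
      and z: "\<And>j. j \<in> samples n i \<Longrightarrow> norm (z t j - zs j (\<theta> t)) \<le> eps"
      using run that by (auto simp: Df_def zs_def)
    have cs: "card (samples n i) = n"
      by (simp add: samples_def)
    have sub: "samples n i \<subseteq> {1..N}"
    proof -
      have "1 \<le> i" "i \<le> m"
        using \<open>i \<in> M\<close> \<open>B \<union> M = {1..m}\<close> by auto
      \<comment> \<open>\<open>1 \<le> i\<close> keeps the natural-number subtraction from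
        truncating.\<close>
      then have "(i - 1) * n + n = i * n" "i * n \<le> N"
        using \<open>N = m * n\<close> by (auto simp: algebra_simps)
      then show ?thesis
        by (auto simp: samples_def)
    qed
    \<comment> \<open>Two sources of error: the inexact maximizer gives
      \<open>L\<^sub>\<theta>\<^sub>z * eps\<close>, the spread of the exact gradients around their
      mean gives \<sigma>.\<close>
    have pointwise: "norm (Df (\<theta> t) (z t j) - h (\<theta> t)) \<le> L\<^sub>\<theta>\<^sub>z * eps + \<sigma>"
      if j: "j \<in> samples n i" for j
    proof -
      have "norm (Df (\<theta> t) (z t j) - Df (\<theta> t) (zs j (\<theta> t))) \<le> L\<^sub>\<theta>\<^sub>z * norm (z t j - zs j (\<theta> t))"
        unfolding Df_def by (rule smooth(3))
      also have "\<dots> \<le> L\<^sub>\<theta>\<^sub>z * eps"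
        by (intro mult_left_mono z [OF j] \<open>0 \<le> L\<^sub>\<theta>\<^sub>z\<close>)
      finally have approx: "norm (Df (\<theta> t) (z t j) - Df (\<theta> t) (zs j (\<theta> t))) \<le> L\<^sub>\<theta>\<^sub>z * eps" .
      have "norm (Df (\<theta> t) (zs j (\<theta> t)) - h (\<theta> t)) \<le> \<sigma>"
        using dev [OF \<open>t < T\<close>] j sub \<open>1 \<le> N\<close> unfolding h_def Df_def zs_def
        by (subst (asm) Max_le_iff) auto
      with approx show ?thesis
        using norm_triangle_ineq [of "Df (\<theta> t) (z t j) - Df (\<theta> t) (zs j (\<theta> t))"
            "Df (\<theta> t) (zs j (\<theta> t)) - h (\<theta> t)"] by simp
    qed
    have "g t i - h (\<theta> t) = (1 / real n) *\<^sub>R (\<Sum>j\<in>samples n i. Df (\<theta> t) (z t j) - h (\<theta> t))"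
      using \<open>1 \<le> n\<close>
      by (simp add: gi sum_subtractf scaleR_right_diff_distrib cs sum_constant_scaleR del: sum_constant)
    moreover have "norm (\<Sum>j\<in>samples n i. Df (\<theta> t) (z t j) - h (\<theta> t))
        \<le> (\<Sum>j\<in>samples n i. L\<^sub>\<theta>\<^sub>z * eps + \<sigma>)"
      by (intro sum_norm_le pointwise)
    ultimately show ?thesis
      using \<open>1 \<le> n\<close> by (simp add: cs field_simps)
  qed

  \<comment> \<open>For \<open>\<alpha> = 0\<close> the constant \<open>C\<^sub>\<alpha>\<close>
    vanishes; otherwise the bound on \<open>r\<close> reads
    \<open>1 + r < 1 / C\<^sub>\<alpha>\<^sup>2\<close>.\<close>
  have C: "(1 + r) * C\<^sub>\<alpha>\<^sup>2 < 1"
  proof (cases "\<alpha> = 0")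
    case True
    then show ?thesis
      using assms(25) by simp
  next
    case False
    have "0 < C\<^sub>\<alpha>"
      using False \<open>0 \<le> \<alpha>\<close> \<open>\<beta> < 1\<close> assms(25) by simp
    have "(1 - \<beta>) / (2 * \<alpha>) = 1 / C\<^sub>\<alpha>"
      by (simp add: assms(25))
    then have "1 + r < 1 / C\<^sub>\<alpha>\<^sup>2"
      using assms(33) [OF False] by (simp add: power_one_over)
    then show ?thesis
      using \<open>0 < C\<^sub>\<alpha>\<close> by (simp add: field_simps)
  qed
  have "\<exists>G. \<theta> (Suc t) = \<theta> t - (1 / L\<^sub>F) *\<^sub>R G
      \<and> norm (G - h (\<theta> t)) \<le> C\<^sub>\<alpha> * norm (h (\<theta> t)) + (L\<^sub>\<theta>\<^sub>z * eps + \<sigma>)" if t: "t < T" for t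
  proof -
    obtain G where G: "norm_screen \<beta> m (g t) G" "\<theta> (Suc t) = \<theta> t - \<eta> *\<^sub>R G"
      using run t by blast
    have "norm (G - h (\<theta> t)) \<le> C\<^sub>\<alpha> * norm (h (\<theta> t)) + (L\<^sub>\<theta>\<^sub>z * eps + \<sigma>)"
      unfolding assms(25)
      by (rule norm_screen_error [OF G(1) assms(5-8) assms(1) assms(10-12) honest [OF t]])
    then show ?thesis
      using G(2) \<open>\<eta> = 1 / L\<^sub>F\<close> by blast
  qed
  then have "(1 / real T) * (\<Sum>t<T. (norm (h (\<theta> t)))\<^sup>2)
           \<le> 2 * L\<^sub>F / ((1 - (1 + r) * C\<^sub>\<alpha>\<^sup>2) * real T) * (F (\<theta> 0) - F \<theta>_opt)
             + (1 + 1 / r) * (L\<^sub>\<theta>\<^sub>z * eps + \<sigma>)\<^sup>2 / (1 - (1 + r) * C\<^sub>\<alpha>\<^sup>2)"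
    by (intro inexact_gradient_descent [OF F_gderiv h_lip]) (use assms(4,24,27,32) C in auto)
  moreover have "grad F \<theta>' = h \<theta>'" for \<theta>'
    by (rule grad_eqI [OF F_gderiv])
  moreover have "\<theta> 0 = \<theta>\<^sub>0"
    using run by blast
  ultimately show ?thesis
    by simp
qed

end
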